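(* Let $(Z_t)_{t\ge0}$ be the driving Gaussian process of the context, satisfying $\mathbf{(H_1)}$, and let $x\in\mathbb{R}^d$. For $\gamma\in(0,1)$ let $(\Sigma_{n\gamma})_{n\ge0}$ be defined by $\Sigma_0=x$ and $$\Sigma_{(n+1)\gamma}=(1-\gamma)\Sigma_{n\gamma}+\Delta_{n+1}\quad\forall n\ge0,\qquad \Delta_n=Z_{n\gamma}-Z_{(n-1)\gamma}.$$ Then, for every $\gamma\in(0,1)$, $(\mathbb{E}[|\Sigma_{n\gamma}|^2])_{n\ge0}$ is a convergent sequence. Denote by $v(\gamma)$ its limit. For every $\gamma_0\in(0,1)$, $$\sup_{\gamma\in(0,\gamma_0]}v(\gamma)<+\infty.$$
   Context: $|\cdot|$ is the Euclidean norm on $\mathbb{R}^d$. $(Z_t)_{t\ge0}=(Z^1_t,\ldots,Z^d_t)_{t\ge0}$ is a continuous centered $\mathbb{R}^d$-valued Gaussian process with $Z_0=0$ and ergodic stationary increments (ergodic: for every $\gamma>0$ the stationary sequence $(\Delta_n)_{n\ge1}$ is ergodic); $c_i$ denotes the function with $\mathbb{E}[(Z^i_t-Z^i_s)^2]=c_i(t-s)$. $\mathbf{(H_1)}$: for every $i\in\{1,\ldots,d\}$, $c_i$ is continuous on $\mathbb{R}_+$ and $\mathcal{C}^2$ on $(0,+\infty)$, and there exist $a_i\in(0,2)$, $b_i>0$ and $C>0$ such that $|c_i''(t)|\le Ct^{-a_i}$ for all $t\in(0,1)$ and $|c_i''(t)|\le Ct^{-b_i}$ for all $t\ge1$. *)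

theory Defs
  imports "HOL-Probability.Probability"
begin

text \<open>
  Processes are indexed by the reals; only the values at times \<open>t \<ge> 0\<close> are ever constrained.
\<close>

text \<open>Point masses count as (degenerate) Gaussian laws.\<close>

definition gaussian_rv :: "'a measure \<Rightarrow> ('a \<Rightarrow> real) \<Rightarrow> bool" where
  "gaussian_rv M X \<longleftrightarrow> X \<in> borel_measurable M \<and>
     (\<exists>\<mu>. (\<exists>\<sigma>>0. distributed M lborel X (normal_density \<mu> \<sigma>)) \<or> (AE \<omega> in M. X \<omega> = \<mu>))"

definition gaussian_process :: "'a measure \<Rightarrow> (real \<Rightarrow> 'a \<Rightarrow> real ^ 'd) \<Rightarrow> bool" where
  "gaussian_process M Z \<longleftrightarrow>
     (\<forall>t\<ge>0. Z t \<in> borel_measurable M) \<and>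
     (\<forall>J (u :: real \<Rightarrow> real ^ 'd). finite J \<and> J \<subseteq> {0..} \<longrightarrow>
        gaussian_rv M (\<lambda>\<omega>. \<Sum>t\<in>J. u t \<bullet> Z t \<omega>))"

definition centered :: "'a measure \<Rightarrow> (real \<Rightarrow> 'a \<Rightarrow> real ^ 'd) \<Rightarrow> bool" where
  "centered M Z \<longleftrightarrow> (\<forall>t\<ge>0. integral\<^sup>L M (Z t) = 0)"

definition continuous_process :: "'a measure \<Rightarrow> (real \<Rightarrow> 'a \<Rightarrow> real ^ 'd) \<Rightarrow> bool" where
  "continuous_process M Z \<longleftrightarrow> (AE \<omega> in M. continuous_on {0..} (\<lambda>t. Z t \<omega>))"

text \<open>Equality in law on the product \<open>\<sigma>\<close>-algebra, i.e. of all finite-dimensional distributions.\<close>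

definition stationary_increments :: "'a measure \<Rightarrow> (real \<Rightarrow> 'a \<Rightarrow> real ^ 'd) \<Rightarrow> bool" where
  "stationary_increments M Z \<longleftrightarrow>
     (\<forall>h\<ge>0. distr M (\<Pi>\<^sub>M t\<in>{0..}. borel) (\<lambda>\<omega>. \<lambda>t\<in>{0..}. Z (h + t) \<omega> - Z h \<omega>) =
             distr M (\<Pi>\<^sub>M t\<in>{0..}. borel) (\<lambda>\<omega>. \<lambda>t\<in>{0..}. Z t \<omega> - Z 0 \<omega>))"

text \<open>Ergodicity of a (stationary) sequence: shift-invariant events have probability 0 or 1.\<close>

definition ergodic_sequence :: "'a measure \<Rightarrow> (nat \<Rightarrow> 'a \<Rightarrow> real ^ 'd) \<Rightarrow> bool" where
  "ergodic_sequence M X \<longleftrightarrow>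
     (\<forall>A \<in> sets (\<Pi>\<^sub>M n\<in>(UNIV :: nat set). (borel :: (real ^ 'd) measure)).
        (\<lambda>u n. u (Suc n)) -` A = A \<longrightarrow>
        measure M {\<omega> \<in> space M. (\<lambda>n. X n \<omega>) \<in> A} \<in> {0, 1})"

definition increment :: "(real \<Rightarrow> 'a \<Rightarrow> real ^ 'd) \<Rightarrow> real \<Rightarrow> nat \<Rightarrow> 'a \<Rightarrow> real ^ 'd" where
  "increment Z \<gamma> n \<omega> = Z (real n * \<gamma>) \<omega> - Z ((real n - 1) * \<gamma>) \<omega>"

text \<open>The increments are numbered from 1, hence the \<open>Suc\<close>.\<close>

definition ergodic_increments :: "'a measure \<Rightarrow> (real \<Rightarrow> 'a \<Rightarrow> real ^ 'd) \<Rightarrow> bool" where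
  "ergodic_increments M Z \<longleftrightarrow> (\<forall>\<gamma>>0. ergodic_sequence M (\<lambda>n. increment Z \<gamma> (Suc n)))"

definition driving_process :: "'a measure \<Rightarrow> (real \<Rightarrow> 'a \<Rightarrow> real ^ 'd) \<Rightarrow> bool" where
  "driving_process M Z \<longleftrightarrow>
     gaussian_process M Z \<and> centered M Z \<and> continuous_process M Z \<and>
     (AE \<omega> in M. Z 0 \<omega> = 0) \<and> stationary_increments M Z \<and> ergodic_increments M Z"

text \<open>This determines \<open>c i\<close> on \<open>{0..}\<close> and leaves it free at negative arguments.\<close>

definition increment_variance ::
    "'a measure \<Rightarrow> (real \<Rightarrow> 'a \<Rightarrow> real ^ 'd) \<Rightarrow> ('d \<Rightarrow> real \<Rightarrow> real) \<Rightarrow> bool" where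
  "increment_variance M Z c \<longleftrightarrow>
     (\<forall>i s t. 0 \<le> s \<and> s \<le> t \<longrightarrow> (\<integral>\<omega>. (Z t \<omega> $ i - Z s \<omega> $ i)\<^sup>2 \<partial>M) = c i (t - s))"

text \<open>Meaningful for open \<open>S\<close>, where \<open>deriv\<close> is the derivative relative to \<open>S\<close>.\<close>

definition C2_on :: "real set \<Rightarrow> (real \<Rightarrow> real) \<Rightarrow> bool" where
  "C2_on S f \<longleftrightarrow> f differentiable_on S \<and> deriv f differentiable_on S \<and>
     continuous_on S (deriv (deriv f))"

definition H1 :: "('d \<Rightarrow> real \<Rightarrow> real) \<Rightarrow> bool" where
  "H1 c \<longleftrightarrow> (\<forall>i. continuous_on {0..} (c i) \<and> C2_on {0<..} (c i) \<and>
     (\<exists>a b C. a \<in> {0<..<2} \<and> b > 0 \<and> C > 0 \<and>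
        (\<forall>t\<in>{0<..<1}. \<bar>deriv (deriv (c i)) t\<bar> \<le> C * t powr (- a)) \<and>
        (\<forall>t\<ge>1. \<bar>deriv (deriv (c i)) t\<bar> \<le> C * t powr (- b))))"

primrec Sig :: "(real \<Rightarrow> 'a \<Rightarrow> real ^ 'd) \<Rightarrow> real ^ 'd \<Rightarrow> real \<Rightarrow> nat \<Rightarrow> 'a \<Rightarrow> real ^ 'd" where
  "Sig Z x \<gamma> 0 = (\<lambda>\<omega>. x)"
| "Sig Z x \<gamma> (Suc n) = (\<lambda>\<omega>. (1 - \<gamma>) *\<^sub>R Sig Z x \<gamma> n \<omega> + increment Z \<gamma> (Suc n) \<omega>)"

end

theory Submission
  imports Defs
begin

text \<open>
  Everything is read off the second moments of the increments. Let \<open>Q t\<close> be the second moment of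
  \<open>norm (Z (s + t) - Z s)\<close>, which is the sum over \<open>i\<close> of \<open>c i t\<close>. It grows at most
  quadratically (lemma \<open>variance_quadratic_growth\<close>): an increment over a long time is a sum of
  \<open>n\<close> increments over times at most 1, so \<open>Q (n * s) \<le> n\<^sup>2 * Q s\<close>, and \<open>Q\<close> is bounded on
  \<open>[0, 1]\<close> by continuity.

  Since \<open>Sig Z x \<gamma> n = (1 - \<gamma>)^n *\<^sub>R x + Sig Z 0 \<gamma> n\<close> and the second summand has mean zero, the
  starting point contributes only a term that tends to 0, and it suffices to study the noise
  \<open>Sig Z 0 \<gamma> n\<close>.

  Summation by parts writes the noise at step \<open>m\<close> as a weighted average of the increments
  \<open>Z (m\<gamma>) - Z ((m - j)\<gamma>)\<close>, the weights being the law of \<open>min T m\<close> with \<open>T\<close> geometric of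
  parameter \<open>\<gamma>\<close>. The typical time lag \<open>\<gamma> * T\<close> is of order 1 whatever \<open>\<gamma>\<close> is, so convexity of
  the squared norm and quadratic growth of \<open>Q\<close> bound the second moment of the noise uniformly
  in both \<open>m\<close> and \<open>\<gamma>\<close> (lemma \<open>noise_second_moment_le\<close>).

  For convergence in \<open>n\<close>, split off the oldest increment: the noise at step \<open>n + 1\<close> is
  \<open>(1 - \<gamma>)^n\<close> times the first increment, plus the noise at step \<open>n\<close> of the process shifted by
  \<open>\<gamma>\<close>, which has the same law as the noise at step \<open>n\<close> by stationarity. Hence consecutive second
  moments differ by \<open>O((1 - \<gamma>)^n)\<close>, a summable error
  (lemma \<open>noise_second_moment_convergent\<close>).
\<close>

section \<open>Random vectors with finite second moment\<close>

definition finite_second_moment :: "'a measure \<Rightarrow> ('a \<Rightarrow> 'b::euclidean_space) \<Rightarrow> bool" where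
  "finite_second_moment M X \<longleftrightarrow> X \<in> borel_measurable M \<and> integrable M (\<lambda>\<omega>. (norm (X \<omega>))\<^sup>2)"

lemma norm_add_square_le:
  fixes u v :: "'b::real_inner"
  shows "(norm (u + v))\<^sup>2 \<le> 2 * (norm u)\<^sup>2 + 2 * (norm v)\<^sup>2"
proof -
  have "(norm (u + v))\<^sup>2 \<le> (norm u + norm v)\<^sup>2"
    by (intro power_mono norm_triangle_ineq) simp
  also have "\<dots> \<le> 2 * (norm u)\<^sup>2 + 2 * (norm v)\<^sup>2"
    using sum_squares_bound[of "norm u" "norm v"] by (simp add: power2_sum)
  finally show ?thesis .
qed

lemma norm_convex_square_le:
  fixes u v :: "'b::real_inner"
  assumes "0 \<le> \<gamma>" "\<gamma> \<le> 1"
  shows "(norm ((1 - \<gamma>) *\<^sub>R u + \<gamma> *\<^sub>R v))\<^sup>2 \<le> (1 - \<gamma>) * (norm u)\<^sup>2 + \<gamma> * (norm v)\<^sup>2"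
proof -
  have "(1 - \<gamma>) * (norm u)\<^sup>2 + \<gamma> * (norm v)\<^sup>2 - (norm ((1 - \<gamma>) *\<^sub>R u + \<gamma> *\<^sub>R v))\<^sup>2
      = (1 - \<gamma>) * \<gamma> * (norm (u - v))\<^sup>2"
    by (simp add: power2_norm_eq_inner inner_add_left inner_add_right inner_diff_left inner_diff_right inner_commute algebra_simps)
  moreover have "0 \<le> (1 - \<gamma>) * \<gamma> * (norm (u - v))\<^sup>2"
    using assms by simp
  ultimately show ?thesis by linarith
qed

lemma finite_second_moment_add:
  assumes "finite_second_moment M X" "finite_second_moment M Y"
  shows "finite_second_moment M (\<lambda>\<omega>. X \<omega> + Y \<omega>)"
proof -
  have [measurable]: "X \<in> borel_measurable M" "Y \<in> borel_measurable M"
    and "integrable M (\<lambda>\<omega>. 2 * (norm (X \<omega>))\<^sup>2 + 2 * (norm (Y \<omega>))\<^sup>2)"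
    using assms by (auto simp: finite_second_moment_def)
  then have "integrable M (\<lambda>\<omega>. (norm (X \<omega> + Y \<omega>))\<^sup>2)"
    by (elim Bochner_Integration.integrable_bound)
       (auto intro!: AE_I2 norm_add_square_le)
  then show ?thesis
    by (simp add: finite_second_moment_def)
qed

lemma finite_second_moment_scaleR:
  assumes "finite_second_moment M X"
  shows "finite_second_moment M (\<lambda>\<omega>. r *\<^sub>R X \<omega>)"
  using assms by (auto simp: finite_second_moment_def power_mult_distrib)

lemma finite_second_moment_diff:
  assumes "finite_second_moment M X" "finite_second_moment M Y"
  shows "finite_second_moment M (\<lambda>\<omega>. X \<omega> - Y \<omega>)"
  using finite_second_moment_add[OF assms(1) finite_second_moment_scaleR[OF assms(2), of "-1"]]
  by simp

lemma (in prob_space) finite_second_moment_const: "finite_second_moment M (\<lambda>\<omega>. v)"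
  by (simp add: finite_second_moment_def)

lemma (in prob_space) finite_second_moment_integrable:
  assumes "finite_second_moment M X"
  shows "integrable M X"
proof -
  have "integrable M (\<lambda>\<omega>. 1 + (norm (X \<omega>))\<^sup>2)" and [measurable]: "X \<in> borel_measurable M"
    using assms by (auto simp: finite_second_moment_def)
  moreover have "r \<le> 1 + r\<^sup>2" if "r \<ge> 0" for r :: real
    using that sum_squares_bound[of 1 r] by simp
  ultimately show ?thesis
    by (elim Bochner_Integration.integrable_bound) (auto intro!: AE_I2)
qed

section \<open>Gaussian processes\<close>

lemma (in prob_space) gaussian_rv_square_integrable:
  assumes "gaussian_rv M X"
  shows "integrable M (\<lambda>\<omega>. (X \<omega>)\<^sup>2)"
proof -
  have [measurable]: "X \<in> borel_measurable M"
    using assms by (simp add: gaussian_rv_def)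
  from assms obtain \<mu> where
    "(\<exists>\<sigma>>0. distributed M lborel X (normal_density \<mu> \<sigma>)) \<or> (AE \<omega> in M. X \<omega> = \<mu>)"
    by (auto simp: gaussian_rv_def)
  then show ?thesis
  proof (elim disjE exE conjE)
    fix \<sigma> :: real
    assume \<sigma>: "\<sigma> > 0" and D: "distributed M lborel X (normal_density \<mu> \<sigma>)"
    have "integrable lborel (\<lambda>t. normal_density \<mu> \<sigma> t * (t - \<mu>)\<^sup>2)"
      by (rule integrable_normal_moment[OF \<sigma>])
    then have "integrable M (\<lambda>\<omega>. (X \<omega> - \<mu>)\<^sup>2)"
      using distributed_integrable[OF D, of "\<lambda>t. (t - \<mu>)\<^sup>2"] by simp
    then have "finite_second_moment M (\<lambda>\<omega>. X \<omega> - \<mu>)"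
      by (simp add: finite_second_moment_def)
    from finite_second_moment_add[OF this finite_second_moment_const, of \<mu>] show ?thesis
      by (simp add: finite_second_moment_def)
  next
    assume "AE \<omega> in M. X \<omega> = \<mu>"
    then have "AE \<omega> in M. (X \<omega>)\<^sup>2 = \<mu>\<^sup>2" by auto
    then show ?thesis
      by (subst integrable_cong_AE[where g = "\<lambda>_. \<mu>\<^sup>2"]) auto
  qed
qed

lemma norm_vec_square_eq_sum: "(norm v)\<^sup>2 = (\<Sum>i\<in>UNIV. (v $ i)\<^sup>2)" for v :: "real ^ 'd"
  by (simp add: norm_vec_def L2_set_def sum_nonneg)

lemma (in prob_space) gaussian_process_finite_second_moment:
  fixes Z :: "real \<Rightarrow> 'a \<Rightarrow> real ^ 'd"
  assumes "gaussian_process M Z" "t \<ge> 0"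
  shows "finite_second_moment M (Z t)"
proof -
  have [measurable]: "Z t \<in> borel_measurable M"
    using assms by (simp add: gaussian_process_def)
  have "gaussian_rv M (\<lambda>\<omega>. Z t \<omega> $ i)" for i
  proof -
    have "\<forall>J (u :: real \<Rightarrow> real ^ 'd). finite J \<and> J \<subseteq> {0..} \<longrightarrow>
        gaussian_rv M (\<lambda>\<omega>. \<Sum>s\<in>J. u s \<bullet> Z s \<omega>)"
      using assms(1) by (simp add: gaussian_process_def)
    from this[rule_format, of "{t}" "\<lambda>_. axis i 1"] assms(2) show ?thesis
      by (simp add: inner_axis')
  qed
  then have "integrable M (\<lambda>\<omega>. (Z t \<omega> $ i)\<^sup>2)" for i
    by (rule gaussian_rv_square_integrable)
  then show ?thesis
    by (simp add: finite_second_moment_def norm_vec_square_eq_sum)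
qed

section \<open>Pathwise properties of the recursion\<close>

lemma Sig_eq_Sig_zero: "Sig Z x \<gamma> n \<omega> = (1 - \<gamma>) ^ n *\<^sub>R x + Sig Z 0 \<gamma> n \<omega>"
  by (induction n) (simp_all add: algebra_simps)

lemma Sig_cong_increment:
  assumes "\<And>n. increment Z \<gamma> (Suc n) \<omega> = increment Z' \<gamma> (Suc n) \<omega>'"
  shows "Sig Z x \<gamma> n \<omega> = Sig Z' x \<gamma> n \<omega>'"
  by (induction n) (simp_all add: assms)

text \<open>
  Peeling off the oldest increment instead of the newest one leaves the noise of the shifted
  process, whose law is known by stationarity.
\<close>

lemma Sig_zero_Suc_shift:
  "Sig Z 0 \<gamma> (Suc n) \<omega> =
     (1 - \<gamma>) ^ n *\<^sub>R increment Z \<gamma> 1 \<omega> + Sig (\<lambda>t. Z (\<gamma> + t)) 0 \<gamma> n \<omega>"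
proof (induction n)
  case 0
  show ?case by (simp add: increment_def)
next
  case (Suc n)
  have "increment Z \<gamma> (Suc (Suc n)) \<omega> = increment (\<lambda>t. Z (\<gamma> + t)) \<gamma> (Suc n) \<omega>"
    by (simp add: increment_def algebra_simps)
  then show ?case
    by (simp only: Sig.simps(2)[of Z 0 \<gamma> "Suc n"] Suc.IH) (simp add: algebra_simps)
qed

text \<open>
  Taking the evaluation process on path space for \<open>Z\<close> exhibits the noise as one fixed measurable
  functional of the path. Equality in law of two processes therefore passes to their noises.
\<close>

lemma Sig_evaluation_measurable:
  assumes "\<gamma> > 0"
  shows "Sig (\<lambda>t u. u t) (0 :: real ^ 'd) \<gamma> n \<in> borel_measurable (\<Pi>\<^sub>M t\<in>{0..}. borel)"
proof (induction n)
  case 0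
  show ?case by simp
next
  case (Suc n)
  have coordinate: "(\<lambda>u. u t) \<in> borel_measurable (\<Pi>\<^sub>M t\<in>{0..}. (borel :: (real ^ 'd) measure))"
    if "t \<ge> 0" for t :: real
    using that by (intro measurable_component_singleton) simp
  have [measurable]: "increment (\<lambda>t u. u t) \<gamma> (Suc n)
      \<in> borel_measurable (\<Pi>\<^sub>M t\<in>{0..}. (borel :: (real ^ 'd) measure))"
    unfolding increment_def using assms by (intro borel_measurable_diff coordinate) auto
  show ?case
    using Suc.IH by simp
qed

section \<open>Processes with stationary increments and finite second moments\<close>

locale stationary_second_order_process = prob_space M for M :: "'a measure" +
  fixes Z :: "real \<Rightarrow> 'a \<Rightarrow> real ^ 'd" and Q :: "real \<Rightarrow> real"
  assumes moment: "t \<ge> 0 \<Longrightarrow> finite_second_moment M (Z t)"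
    and variance_increment:
      "0 \<le> s \<Longrightarrow> s \<le> t \<Longrightarrow> (\<integral>\<omega>. (norm (Z t \<omega> - Z s \<omega>))\<^sup>2 \<partial>M) = Q (t - s)"
    and stationary: "stationary_increments M Z"
    and continuous_variance: "continuous_on {0..} Q"
begin

lemma variance_nonneg: "t \<ge> 0 \<Longrightarrow> Q t \<ge> 0"
  using variance_increment[of 0 t, symmetric] by simp

lemma moment_diff:
  "s \<ge> 0 \<Longrightarrow> t \<ge> 0 \<Longrightarrow> finite_second_moment M (\<lambda>\<omega>. Z t \<omega> - Z s \<omega>)"
  by (intro finite_second_moment_diff moment)

text \<open>
  Cut the increment over \<open>n * s\<close> into \<open>n\<close> increments over \<open>s\<close>; the factor \<open>n\<^sup>2\<close>, which is reached
  by \<open>Z t = t *\<^sub>R X\<close>, comes from Cauchy--Schwarz and allows for any correlation between the pieces.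
\<close>

lemma variance_multiple_le:
  assumes "s \<ge> 0"
  shows "Q (real n * s) \<le> (real n)\<^sup>2 * Q s"
proof -
  let ?D = "\<lambda>k \<omega>. Z (real (Suc k) * s) \<omega> - Z (real k * s) \<omega>"
  have int: "integrable M (\<lambda>\<omega>. (norm (?D k \<omega>))\<^sup>2)" for k
    using moment_diff[of "real k * s" "real (Suc k) * s"] assms
    by (simp add: finite_second_moment_def)
  have "Q (real n * s) = (\<integral>\<omega>. (norm (Z (real n * s) \<omega> - Z 0 \<omega>))\<^sup>2 \<partial>M)"
    using variance_increment[of 0 "real n * s"] assms by simp
  also have "\<dots> \<le> (\<integral>\<omega>. real n * (\<Sum>k<n. (norm (?D k \<omega>))\<^sup>2) \<partial>M)"
  proof (rule integral_mono)
    show "integrable M (\<lambda>\<omega>. (norm (Z (real n * s) \<omega> - Z 0 \<omega>))\<^sup>2)"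
      using moment_diff[of 0 "real n * s"] assms by (simp add: finite_second_moment_def)
    show "integrable M (\<lambda>\<omega>. real n * (\<Sum>k<n. (norm (?D k \<omega>))\<^sup>2))"
      by (intro integrable_mult_right Bochner_Integration.integrable_sum int)
    fix \<omega>
    have "Z (real n * s) \<omega> - Z 0 \<omega> = (\<Sum>k<n. ?D k \<omega>)"
      by (subst sum_lessThan_telescope[where f = "\<lambda>k. Z (real k * s) \<omega>"]) simp
    then have "(norm (Z (real n * s) \<omega> - Z 0 \<omega>))\<^sup>2 \<le> (\<Sum>k<n. norm (?D k \<omega>))\<^sup>2"
      by (simp only:) (intro power_mono norm_sum norm_ge_zero)
    also have "\<dots> \<le> real n * (\<Sum>k<n. (norm (?D k \<omega>))\<^sup>2)"
      using sum_squared_le_sum_of_squares[of "\<lambda>k. norm (?D k \<omega>)" "{..<n}"]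
      by (simp add: mult.commute)
    finally show "(norm (Z (real n * s) \<omega> - Z 0 \<omega>))\<^sup>2 \<le> real n * (\<Sum>k<n. (norm (?D k \<omega>))\<^sup>2)" .
  qed
  also have "\<dots> = real n * (\<Sum>k<n. \<integral>\<omega>. (norm (?D k \<omega>))\<^sup>2 \<partial>M)"
    by (simp add: Bochner_Integration.integral_sum int del: of_nat_Suc)
  also have "(\<Sum>k<n. \<integral>\<omega>. (norm (?D k \<omega>))\<^sup>2 \<partial>M) = (\<Sum>k<n. Q s)"
  proof (rule sum.cong[OF refl])
    fix k
    show "(\<integral>\<omega>. (norm (?D k \<omega>))\<^sup>2 \<partial>M) = Q s"
      using variance_increment[of "real k * s" "real (Suc k) * s"] assms
      by (simp add: algebra_simps)
  qed
  finally show ?thesis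
    by (simp add: power2_eq_square)
qed

lemma variance_quadratic_growth:
  obtains A where "A \<ge> 0" "\<And>t. t \<ge> 0 \<Longrightarrow> Q t \<le> A * (1 + t\<^sup>2)"
proof -
  have "compact (Q ` {0..1})"
    by (intro compact_continuous_image continuous_on_subset[OF continuous_variance]) auto
  then have "bdd_above (Q ` {0..1})"
    by (intro bounded_imp_bdd_above compact_imp_bounded)
  then obtain K where "\<forall>t\<in>{0..1}. Q t \<le> K"
    by (auto simp: bdd_above_def)
  then have K: "Q t \<le> K" if "0 \<le> t" "t \<le> 1" for t
    using that by simp
  have K0: "K \<ge> 0"
    using K[of 0] variance_nonneg[of 0] by simp
  have "Q t \<le> (2 * K) * (1 + t\<^sup>2)" if t: "t \<ge> 0" for t
  proof -
    \<comment> \<open>\<open>t\<close> is cut into \<open>n\<close> pieces of length at most 1, with \<open>n\<close> at most \<open>1 + t\<close>.\<close>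
    define n where "n = Suc (nat \<lfloor>t\<rfloor>)"
    have n: "t \<le> real n" "real n \<le> 1 + t" "real n > 0"
      using t unfolding n_def by linarith+
    have "Q t = Q (real n * (t / real n))"
      using n by simp
    also have "\<dots> \<le> (real n)\<^sup>2 * Q (t / real n)"
      using t n by (intro variance_multiple_le) simp
    also have "\<dots> \<le> (1 + t)\<^sup>2 * K"
      using t n by (intro mult_mono power_mono K variance_nonneg) (auto simp: field_simps)
    also have "\<dots> \<le> (2 * (1 + t\<^sup>2)) * K"
      using K0 sum_squares_bound[of 1 t] by (intro mult_right_mono) (auto simp: power2_sum)
    finally show ?thesis by (simp add: mult_ac)
  qed
  with K0 show ?thesis
    by (intro that[of "2 * K"]) auto
qed

lemma increment_moment:
  assumes "\<gamma> > 0"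
  shows "finite_second_moment M (increment Z \<gamma> (Suc n))"
  unfolding increment_def using assms by (intro moment_diff) auto

lemma Sig_moment:
  assumes "\<gamma> > 0"
  shows "finite_second_moment M (Sig Z x \<gamma> n)"
  by (induction n)
     (auto intro!: finite_second_moment_add finite_second_moment_scaleR
       finite_second_moment_const increment_moment[OF assms])

text \<open>
  The averaging over a geometric lag is done one step at a time. For the fixed horizon \<open>m\<close>, the
  variables \<open>U n\<close>, the noise at step \<open>n\<close> plus the whole remaining increment \<open>D n\<close> up to \<open>m\<close>,
  interpolate between \<open>Z (m\<gamma>) - Z 0\<close> at \<open>n = 0\<close> and the noise at \<open>n = m\<close>, and \<open>U (Suc n)\<close> is the
  convex combination of \<open>U n\<close> and \<open>D n\<close> with weights \<open>1 - \<gamma>\<close> and \<open>\<gamma>\<close>.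
\<close>

lemma noise_second_moment_le:
  assumes \<gamma>: "0 < \<gamma>" "\<gamma> < 1"
    and A: "A \<ge> 0" "\<And>t. t \<ge> 0 \<Longrightarrow> Q t \<le> A * (1 + t\<^sup>2)"
  shows "(\<integral>\<omega>. (norm (Sig Z 0 \<gamma> m \<omega>))\<^sup>2 \<partial>M) \<le> 3 * A"
proof -
  define D where "D n \<omega> = Z (real m * \<gamma>) \<omega> - Z (real n * \<gamma>) \<omega>" for n \<omega>
  define U where "U n \<omega> = D n \<omega> + Sig Z 0 \<gamma> n \<omega>" for n \<omega>
  define s where "s n = (real m - real n) * \<gamma>" for n
  have D_moment: "finite_second_moment M (D n)" for n
    unfolding D_def using \<gamma> by (intro moment_diff) auto
  have U_moment: "finite_second_moment M (U n)" for n
    unfolding U_def by (intro finite_second_moment_add D_moment Sig_moment \<gamma>)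
  have D_le: "(\<integral>\<omega>. (norm (D n \<omega>))\<^sup>2 \<partial>M) \<le> A * (1 + (s n)\<^sup>2)" if "n \<le> m" for n
    using variance_increment[of "real n * \<gamma>" "real m * \<gamma>"] A(2)[of "s n"] that \<gamma>
    by (simp add: D_def s_def left_diff_distrib)
  have U_Suc: "U (Suc n) \<omega> = (1 - \<gamma>) *\<^sub>R U n \<omega> + \<gamma> *\<^sub>R D n \<omega>" for n \<omega>
    by (simp add: U_def D_def increment_def algebra_simps)
  \<comment> \<open>With \<open>f s = s\<^sup>2 + 2 * s + 3\<close> the induction goes through because
    \<open>(1 - \<gamma>) * f s + \<gamma> * (1 + s\<^sup>2) \<le> f (s - \<gamma>)\<close>; the two sides differ by exactly \<open>\<gamma>\<^sup>2\<close>.\<close>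
  have "(\<integral>\<omega>. (norm (U n \<omega>))\<^sup>2 \<partial>M) \<le> A * ((s n)\<^sup>2 + 2 * s n + 3)" if "n \<le> m" for n
    using that
  proof (induction n)
    case 0
    have "(\<integral>\<omega>. (norm (U 0 \<omega>))\<^sup>2 \<partial>M) \<le> A * (1 + (s 0)\<^sup>2)"
      using D_le[of 0] by (simp add: U_def)
    also have "\<dots> \<le> A * ((s 0)\<^sup>2 + 2 * s 0 + 3)"
      using A(1) \<gamma> by (intro mult_left_mono) (auto simp: s_def)
    finally show ?case .
  next
    case (Suc n)
    have "(\<integral>\<omega>. (norm (U (Suc n) \<omega>))\<^sup>2 \<partial>M)
        \<le> (\<integral>\<omega>. (1 - \<gamma>) * (norm (U n \<omega>))\<^sup>2 + \<gamma> * (norm (D n \<omega>))\<^sup>2 \<partial>M)"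
    proof (rule integral_mono)
      show "integrable M (\<lambda>\<omega>. (norm (U (Suc n) \<omega>))\<^sup>2)"
        using U_moment by (simp add: finite_second_moment_def)
      show "integrable M (\<lambda>\<omega>. (1 - \<gamma>) * (norm (U n \<omega>))\<^sup>2 + \<gamma> * (norm (D n \<omega>))\<^sup>2)"
        using U_moment D_moment by (simp add: finite_second_moment_def)
      show "(norm (U (Suc n) \<omega>))\<^sup>2 \<le> (1 - \<gamma>) * (norm (U n \<omega>))\<^sup>2 + \<gamma> * (norm (D n \<omega>))\<^sup>2" for \<omega>
        unfolding U_Suc using \<gamma> by (intro norm_convex_square_le) auto
    qed
    also have "\<dots> = (1 - \<gamma>) * (\<integral>\<omega>. (norm (U n \<omega>))\<^sup>2 \<partial>M) + \<gamma> * (\<integral>\<omega>. (norm (D n \<omega>))\<^sup>2 \<partial>M)"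
      using U_moment D_moment by (simp add: finite_second_moment_def)
    also have "\<dots> \<le> (1 - \<gamma>) * (A * ((s n)\<^sup>2 + 2 * s n + 3)) + \<gamma> * (A * (1 + (s n)\<^sup>2))"
      using Suc \<gamma> D_le[of n] by (intro add_mono mult_left_mono) auto
    also have "\<dots> = A * ((s (Suc n))\<^sup>2 + 2 * s (Suc n) + 3) - A * \<gamma>\<^sup>2"
      by (simp add: s_def algebra_simps power2_eq_square)
    also have "\<dots> \<le> A * ((s (Suc n))\<^sup>2 + 2 * s (Suc n) + 3)"
      using A(1) by simp
    finally show ?case .
  qed
  from this[of m] show ?thesis
    by (simp add: U_def D_def s_def mult.commute)
qed

lemma noise_second_moment_shift:
  assumes \<gamma>: "\<gamma> > 0" and h: "h \<ge> 0"
  shows "(\<integral>\<omega>. (norm (Sig (\<lambda>t. Z (h + t)) 0 \<gamma> n \<omega>))\<^sup>2 \<partial>M) =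
         (\<integral>\<omega>. (norm (Sig Z 0 \<gamma> n \<omega>))\<^sup>2 \<partial>M)"
proof -
  let ?P = "\<Pi>\<^sub>M t\<in>{0::real..}. (borel :: (real ^ 'd) measure)"
  let ?S = "Sig (\<lambda>t u. u t) (0 :: real ^ 'd) \<gamma> n"
  let ?path = "\<lambda>h \<omega>. \<lambda>t\<in>{0..}. Z (h + t) \<omega> - Z h \<omega>"
  have [measurable]: "?S \<in> borel_measurable ?P"
    by (rule Sig_evaluation_measurable[OF \<gamma>])
  have moment_path: "(\<integral>\<omega>. (norm (Sig (\<lambda>t. Z (g + t)) 0 \<gamma> n \<omega>))\<^sup>2 \<partial>M)
      = (\<integral>u. (norm (?S u))\<^sup>2 \<partial>distr M ?P (?path g))" if g: "g \<ge> 0" for g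
  proof -
    have [measurable]: "?path g \<in> measurable M ?P"
    proof (rule measurable_restrict)
      fix t :: real
      assume "t \<in> {0..}"
      then show "(\<lambda>\<omega>. Z (g + t) \<omega> - Z g \<omega>) \<in> borel_measurable M"
        using moment_diff[of g "g + t"] g by (simp add: finite_second_moment_def)
    qed
    have "Sig (\<lambda>t. Z (g + t)) 0 \<gamma> n \<omega> = ?S (?path g \<omega>)" for \<omega>
      using \<gamma> by (intro Sig_cong_increment) (simp add: increment_def)
    then show ?thesis
      by (simp add: integral_distr)
  qed
  have "distr M ?P (?path h) = distr M ?P (?path 0)"
    using stationary h by (simp add: stationary_increments_def)
  then show ?thesis
    using moment_path[OF h] moment_path[of 0] by simp
qed

text \<open>
  The second moments have absolutely summable differences: by \<open>Sig_zero_Suc_shift\<close> passing from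
  \<open>n\<close> to \<open>n + 1\<close> amounts, in law, to adding \<open>(1 - \<gamma>)^n\<close> times a fixed random vector, and the
  uniform bound keeps the cross term under control.
\<close>

lemma noise_second_moment_convergent:
  assumes \<gamma>: "0 < \<gamma>" "\<gamma> < 1"
  shows "convergent (\<lambda>n. \<integral>\<omega>. (norm (Sig Z 0 \<gamma> n \<omega>))\<^sup>2 \<partial>M)"
proof -
  define a where "a n = (\<integral>\<omega>. (norm (Sig Z 0 \<gamma> n \<omega>))\<^sup>2 \<partial>M)" for n
  define \<Delta> where "\<Delta> = increment Z \<gamma> 1"
  define Y where "Y n = Sig (\<lambda>t. Z (\<gamma> + t)) 0 \<gamma> n" for n
  obtain A where A: "A \<ge> 0" "\<And>t. t \<ge> 0 \<Longrightarrow> Q t \<le> A * (1 + t\<^sup>2)"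
    using variance_quadratic_growth by blast
  have a_le: "a n \<le> 3 * A" for n
    unfolding a_def by (rule noise_second_moment_le[OF \<gamma> A])
  have a_shift: "(\<integral>\<omega>. (norm (Y n \<omega>))\<^sup>2 \<partial>M) = a n" for n
    unfolding a_def Y_def using \<gamma> by (intro noise_second_moment_shift) auto
  have Delta_moment: "finite_second_moment M \<Delta>"
    unfolding \<Delta>_def using increment_moment[OF \<gamma>(1), of 0] by simp
  have Sig_Suc: "Sig Z 0 \<gamma> (Suc n) \<omega> = (1 - \<gamma>) ^ n *\<^sub>R \<Delta> \<omega> + Y n \<omega>" for n \<omega>
    unfolding \<Delta>_def Y_def by (rule Sig_zero_Suc_shift)
  have Y_moment: "finite_second_moment M (Y n)" for n
  proof -
    have "Y n = (\<lambda>\<omega>. Sig Z 0 \<gamma> (Suc n) \<omega> - (1 - \<gamma>) ^ n *\<^sub>R \<Delta> \<omega>)"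
      by (simp only: Sig_Suc) simp
    then show ?thesis
      by (simp only:)
         (intro finite_second_moment_diff Sig_moment finite_second_moment_scaleR Delta_moment \<gamma>)
  qed
  have int: "integrable M (\<lambda>\<omega>. (norm (\<Delta> \<omega>))\<^sup>2)" "integrable M (\<lambda>\<omega>. (norm (Y n \<omega>))\<^sup>2)"
      "integrable M (\<lambda>\<omega>. (norm (Sig Z 0 \<gamma> n \<omega>))\<^sup>2)" for n
    using Delta_moment Y_moment Sig_moment[OF \<gamma>(1)] by (simp_all add: finite_second_moment_def)
  have pointwise: "\<bar>(norm (r *\<^sub>R u + v))\<^sup>2 - (norm v)\<^sup>2\<bar> \<le> r * (2 * (norm u)\<^sup>2 + (norm v)\<^sup>2)"
    if r: "0 \<le> r" "r \<le> 1" for r and u v :: "real ^ 'd"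
  proof -
    have "(norm (r *\<^sub>R u + v))\<^sup>2 - (norm v)\<^sup>2 = r * (r * (norm u)\<^sup>2 + 2 * (u \<bullet> v))"
      by (simp add: power2_norm_eq_inner inner_add_left inner_add_right inner_commute
          distrib_left mult.assoc)
    also have "\<bar>\<dots>\<bar> \<le> r * (2 * (norm u)\<^sup>2 + (norm v)\<^sup>2)"
    proof -
      have "\<bar>2 * (u \<bullet> v)\<bar> \<le> (norm u)\<^sup>2 + (norm v)\<^sup>2"
        using Cauchy_Schwarz_ineq2[of u v] sum_squares_bound[of "norm u" "norm v"] by simp
      moreover have "0 \<le> r * (norm u)\<^sup>2" "r * (norm u)\<^sup>2 \<le> (norm u)\<^sup>2"
        using r by (auto intro: mult_left_le_one_le)
      ultimately have "\<bar>r * (norm u)\<^sup>2 + 2 * (u \<bullet> v)\<bar> \<le> 2 * (norm u)\<^sup>2 + (norm v)\<^sup>2"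
        by linarith
      then show ?thesis
        using r by (simp add: abs_mult mult_left_mono)
    qed
    finally show ?thesis .
  qed
  define B where "B = 2 * (\<integral>\<omega>. (norm (\<Delta> \<omega>))\<^sup>2 \<partial>M) + 3 * A"
  have step: "norm (a (Suc n) - a n) \<le> B * (1 - \<gamma>) ^ n" for n
  proof -
    have "a (Suc n) - a n =
        (\<integral>\<omega>. (norm (Sig Z 0 \<gamma> (Suc n) \<omega>))\<^sup>2 - (norm (Y n \<omega>))\<^sup>2 \<partial>M)"
      using int(2)[of n] int(3)[of "Suc n"] a_shift[of n] by (simp only: a_def Bochner_Integration.integral_diff)
    also have "norm \<dots> \<le> (\<integral>\<omega>. (1 - \<gamma>) ^ n * (2 * (norm (\<Delta> \<omega>))\<^sup>2 + (norm (Y n \<omega>))\<^sup>2) \<partial>M)"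
    proof (rule order_trans[OF integral_norm_bound integral_mono])
      show "integrable M (\<lambda>\<omega>. norm ((norm (Sig Z 0 \<gamma> (Suc n) \<omega>))\<^sup>2 - (norm (Y n \<omega>))\<^sup>2))"
        by (intro integrable_norm Bochner_Integration.integrable_diff int)
      show "integrable M (\<lambda>\<omega>. (1 - \<gamma>) ^ n * (2 * (norm (\<Delta> \<omega>))\<^sup>2 + (norm (Y n \<omega>))\<^sup>2))"
        by (intro integrable_mult_right Bochner_Integration.integrable_add int)
      show "norm ((norm (Sig Z 0 \<gamma> (Suc n) \<omega>))\<^sup>2 - (norm (Y n \<omega>))\<^sup>2)
          \<le> (1 - \<gamma>) ^ n * (2 * (norm (\<Delta> \<omega>))\<^sup>2 + (norm (Y n \<omega>))\<^sup>2)" for \<omega>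
        unfolding Sig_Suc real_norm_def using \<gamma> by (intro pointwise power_le_one) auto
    qed
    also have "\<dots> = (1 - \<gamma>) ^ n * (2 * (\<integral>\<omega>. (norm (\<Delta> \<omega>))\<^sup>2 \<partial>M) + a n)"
      by (simp add: int a_shift)
    also have "\<dots> \<le> (1 - \<gamma>) ^ n * B"
      unfolding B_def using \<gamma> a_le[of n] by (intro mult_left_mono) auto
    finally show ?thesis by (simp add: mult.commute)
  qed
  have "summable (\<lambda>n. a (Suc n) - a n)"
    using \<gamma> by (intro summable_comparison_test'[OF _ step] summable_mult summable_geometric) auto
  then have "convergent (\<lambda>n. (\<Sum>k<n. a (Suc k) - a k))"
    by (simp add: summable_iff_convergent)
  then have "convergent (\<lambda>n. (a n - a 0) + a 0)"
    by (intro convergent_add) (simp_all add: sum_lessThan_telescope convergent_const)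
  then show ?thesis
    by (simp add: a_def[abs_def])
qed

lemma Sig_second_moment:
  assumes \<gamma>: "\<gamma> > 0" and "centered M Z"
  shows "(\<integral>\<omega>. (norm (Sig Z x \<gamma> n \<omega>))\<^sup>2 \<partial>M) =
    ((1 - \<gamma>)\<^sup>2) ^ n * (norm x)\<^sup>2 + (\<integral>\<omega>. (norm (Sig Z 0 \<gamma> n \<omega>))\<^sup>2 \<partial>M)"
proof -
  have Z_integrable: "integrable M (Z t)" if "t \<ge> 0" for t
    by (intro finite_second_moment_integrable moment that)
  have increment_mean: "(\<integral>\<omega>. increment Z \<gamma> (Suc k) \<omega> \<partial>M) = 0" for k
    using \<gamma> \<open>centered M Z\<close> Z_integrable by (simp add: increment_def centered_def)
  have Sig_integrable: "integrable M (Sig Z 0 \<gamma> k)" for k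
    by (intro finite_second_moment_integrable Sig_moment \<gamma>)
  have incr_integrable: "integrable M (increment Z \<gamma> (Suc k))" for k
    by (intro finite_second_moment_integrable increment_moment \<gamma>)
  have mean: "(\<integral>\<omega>. Sig Z 0 \<gamma> k \<omega> \<partial>M) = 0" for k
    by (induction k) (simp_all add: Sig_integrable incr_integrable increment_mean)
  define p where "p = (1 - \<gamma>) ^ n *\<^sub>R x"
  have square: "integrable M (\<lambda>\<omega>. (norm (Sig Z 0 \<gamma> n \<omega>))\<^sup>2)"
    using Sig_moment[OF \<gamma>, of 0 n] by (simp add: finite_second_moment_def)
  have "(norm (Sig Z x \<gamma> n \<omega>))\<^sup>2 = (norm p)\<^sup>2 + 2 * (p \<bullet> Sig Z 0 \<gamma> n \<omega>) + (norm (Sig Z 0 \<gamma> n \<omega>))\<^sup>2" for \<omega>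
    unfolding Sig_eq_Sig_zero[of Z x] p_def[symmetric]
    by (simp add: power2_norm_eq_inner inner_add inner_commute)
  then have "(\<integral>\<omega>. (norm (Sig Z x \<gamma> n \<omega>))\<^sup>2 \<partial>M) = (norm p)\<^sup>2 + 2 * (p \<bullet> (\<integral>\<omega>. Sig Z 0 \<gamma> n \<omega> \<partial>M))
      + (\<integral>\<omega>. (norm (Sig Z 0 \<gamma> n \<omega>))\<^sup>2 \<partial>M)"
    using square Sig_integrable[of n] by (simp add: prob_space)
  then show ?thesis
    by (simp add: mean p_def power_mult_distrib flip: power_mult) (simp add: mult.commute)
qed

end

section \<open>The driving Gaussian process\<close>

lemma driving_process_second_order:
  fixes Z :: "real \<Rightarrow> 'a \<Rightarrow> real ^ 'd"
  assumes "prob_space M" "driving_process M Z" "increment_variance M Z c" "H1 c"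
  shows "stationary_second_order_process M Z (\<lambda>t. \<Sum>i\<in>UNIV. c i t)"
proof -
  interpret prob_space M by fact
  have moment: "finite_second_moment M (Z t)" if "t \<ge> 0" for t
    using assms(2) that by (simp add: driving_process_def gaussian_process_finite_second_moment)
  show ?thesis
  proof unfold_locales
    fix s t :: real
    assume st: "0 \<le> s" "s \<le> t"
    have diff: "finite_second_moment M (\<lambda>\<omega>. Z t \<omega> - Z s \<omega>)"
      using st by (intro finite_second_moment_diff moment) auto
    have component: "integrable M (\<lambda>\<omega>. ((Z t \<omega> - Z s \<omega>) $ i)\<^sup>2)" for i
    proof (rule Bochner_Integration.integrable_bound)
      show "integrable M (\<lambda>\<omega>. (norm (Z t \<omega> - Z s \<omega>))\<^sup>2)"
        using diff by (simp add: finite_second_moment_def)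
      have "(\<lambda>\<omega>. (Z t \<omega> - Z s \<omega>) $ i) \<in> borel_measurable M"
        using borel_measurable_inner[OF borel_measurable_const, of "\<lambda>\<omega>. Z t \<omega> - Z s \<omega>" M "axis i 1"] diff
        by (simp add: finite_second_moment_def inner_axis')
      then show "(\<lambda>\<omega>. ((Z t \<omega> - Z s \<omega>) $ i)\<^sup>2) \<in> borel_measurable M"
        by (rule borel_measurable_power)
      have "(v $ i)\<^sup>2 \<le> (norm v)\<^sup>2" for v :: "real ^ 'd"
        using component_le_norm_cart[of v i] by (metis abs_ge_zero power2_abs power_mono)
      then show "AE \<omega> in M. norm (((Z t \<omega> - Z s \<omega>) $ i)\<^sup>2) \<le> norm ((norm (Z t \<omega> - Z s \<omega>))\<^sup>2)"
        by (intro AE_I2) (simp del: vector_minus_component)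
    qed
    then show "(\<integral>\<omega>. (norm (Z t \<omega> - Z s \<omega>))\<^sup>2 \<partial>M) = (\<Sum>i\<in>UNIV. c i (t - s))"
      using assms(3) st
      by (simp add: norm_vec_square_eq_sum Bochner_Integration.integral_sum increment_variance_def)
  next
    show "continuous_on {0..} (\<lambda>t. \<Sum>i\<in>UNIV. c i t)"
      using assms(4) by (intro continuous_on_sum) (simp add: H1_def)
  qed (use assms(2) moment in \<open>auto simp: driving_process_def\<close>)
qed

theorem lemma2:
  fixes M :: "'a measure" and Z :: "real \<Rightarrow> 'a \<Rightarrow> real ^ 'd"
    and c :: "'d \<Rightarrow> real \<Rightarrow> real" and x :: "real ^ 'd"
  assumes "prob_space M"
    and "driving_process M Z"
    and "increment_variance M Z c"
    and "H1 c"
  shows "(\<forall>\<gamma>\<in>{0<..<1}.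
            (\<forall>n. integrable M (\<lambda>\<omega>. (norm (Sig Z x \<gamma> n \<omega>))\<^sup>2)) \<and>
            convergent (\<lambda>n. \<integral>\<omega>. (norm (Sig Z x \<gamma> n \<omega>))\<^sup>2 \<partial>M)) \<and>
         (\<forall>\<gamma>\<^sub>0\<in>{0<..<1}.
            (SUP \<gamma>\<in>{0<..\<gamma>\<^sub>0}. ereal (lim (\<lambda>n. \<integral>\<omega>. (norm (Sig Z x \<gamma> n \<omega>))\<^sup>2 \<partial>M))) < \<infinity>)"
proof -
  define Q where "Q t = (\<Sum>i\<in>UNIV. c i t)" for t
  interpret stationary_second_order_process M Z Q
    unfolding Q_def[abs_def] by (rule driving_process_second_order) fact+
  have centered: "centered M Z"
    using assms(2) by (simp add: driving_process_def)
  obtain A where A: "A \<ge> 0" "\<And>t. t \<ge> 0 \<Longrightarrow> Q t \<le> A * (1 + t\<^sup>2)"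
    using variance_quadratic_growth by blast
  define v where "v \<gamma> = lim (\<lambda>n. \<integral>\<omega>. (norm (Sig Z 0 \<gamma> n \<omega>))\<^sup>2 \<partial>M)" for \<gamma>
  have limit: "(\<lambda>n. \<integral>\<omega>. (norm (Sig Z x \<gamma> n \<omega>))\<^sup>2 \<partial>M) \<longlonglongrightarrow> v \<gamma>" and bound: "v \<gamma> \<le> 3 * A"
    if \<gamma>: "0 < \<gamma>" "\<gamma> < 1" for \<gamma>
  proof -
    have noise: "(\<lambda>n. \<integral>\<omega>. (norm (Sig Z 0 \<gamma> n \<omega>))\<^sup>2 \<partial>M) \<longlonglongrightarrow> v \<gamma>"
      unfolding v_def using noise_second_moment_convergent[OF \<gamma>] by (simp add: convergent_LIMSEQ_iff)
    have "(\<lambda>n. ((1 - \<gamma>)\<^sup>2) ^ n) \<longlonglongrightarrow> 0"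
      using \<gamma> by (intro LIMSEQ_realpow_zero) (auto simp: power_less_one_iff)
    from tendsto_add[OF tendsto_mult_right[OF this, of "(norm x)\<^sup>2"] noise]
    show "(\<lambda>n. \<integral>\<omega>. (norm (Sig Z x \<gamma> n \<omega>))\<^sup>2 \<partial>M) \<longlonglongrightarrow> v \<gamma>"
      by (simp add: Sig_second_moment[OF \<gamma>(1) centered, of x])
    show "v \<gamma> \<le> 3 * A"
      using noise noise_second_moment_le[OF \<gamma> A] by (intro LIMSEQ_le_const2) auto
  qed
  have "(SUP \<gamma>\<in>{0<..\<gamma>\<^sub>0}. ereal (lim (\<lambda>n. \<integral>\<omega>. (norm (Sig Z x \<gamma> n \<omega>))\<^sup>2 \<partial>M))) < \<infinity>"
    if "\<gamma>\<^sub>0 < 1" for \<gamma>\<^sub>0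
  proof -
    have "(SUP \<gamma>\<in>{0<..\<gamma>\<^sub>0}. ereal (lim (\<lambda>n. \<integral>\<omega>. (norm (Sig Z x \<gamma> n \<omega>))\<^sup>2 \<partial>M))) \<le> ereal (3 * A)"
      using that limit[THEN limI] bound by (intro SUP_least) auto
    also have "\<dots> < \<infinity>" by simp
    finally show ?thesis .
  qed
  moreover have "integrable M (\<lambda>\<omega>. (norm (Sig Z x \<gamma> n \<omega>))\<^sup>2)" if "\<gamma> > 0" for \<gamma> n
    using Sig_moment[OF that] by (simp add: finite_second_moment_def)
  moreover have "convergent (\<lambda>n. \<integral>\<omega>. (norm (Sig Z x \<gamma> n \<omega>))\<^sup>2 \<partial>M)" if "0 < \<gamma>" "\<gamma> < 1" for \<gamma>
    using limit[OF that] by (rule convergentI)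
  ultimately show ?thesis by auto
qed

end
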